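(* Let $\alpha,\beta\in\mathbb{R}$, let $K\in\mathbb{R}^{M\times M}$ be the symmetric discretization matrix described in the context, and let $$\mathcal{A}=\begin{bmatrix}\beta I & K+\alpha I\\ K+\alpha I & -\beta I\end{bmatrix}\in\mathbb{R}^{2M\times 2M},\qquad \tilde{\mathcal{A}}=\begin{bmatrix}\sqrt{(K+\alpha I)^2+\beta^2 I} & 0\\ 0 & \sqrt{(K+\alpha I)^2+\beta^2 I}\end{bmatrix}.$$ Assume that $\mathcal{A}$ is nonsingular. Then for any right-hand side $\begin{bmatrix}\mathbf{a}\\ \mathbf{b}\end{bmatrix}\in\mathbb{R}^{2M}$ and any real initial guess, the MINRES solver with $\tilde{\mathcal{A}}$ as preconditioner, applied to the linear system $$\mathcal{A}\begin{bmatrix}\mathbf{z}_1\\ \mathbf{z}_2\end{bmatrix}=\begin{bmatrix}\mathbf{a}\\ \mathbf{b}\end{bmatrix},$$ finds the exact solution within $2$ iterations.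
   Context: $K\in\mathbb{R}^{M\times M}$ is a real symmetric matrix arising from a finite difference discretization on a rectangular domain of the operator $-\nabla(a(\mathbf{x})\nabla)$, where $0<\check{a}\le a(\mathbf{x})\le\hat{a}$. $I$ is the $M\times M$ identity matrix, and $\sqrt{H}$ denotes the positive semidefinite square root of a symmetric positive semidefinite matrix $H$. MINRES for $\mathbf{A}\mathbf{x}=\mathbf{y}$ ($\mathbf{A}$ real symmetric nonsingular) with symmetric positive definite preconditioner $\mathbf{P}$ and initial guess $\mathbf{x}_0$: the $k$th iterate $\mathbf{x}_k$ minimizes the $\mathbf{P}^{-1}$-norm $\big((\mathbf{y}-\mathbf{A}\mathbf{x})^{\rm T}\mathbf{P}^{-1}(\mathbf{y}-\mathbf{A}\mathbf{x})\big)^{1/2}$ over $\mathbf{x}\in\mathbf{x}_0+\mathrm{span}\{(\mathbf{P}^{-1}\mathbf{A})^j\mathbf{P}^{-1}(\mathbf{y}-\mathbf{A}\mathbf{x}_0):0\le j\le k-1\}$ (exact arithmetic). *)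

theory Defs
  imports "HOL-Analysis.Analysis"
begin

(* The index type 'n + 'n has 2 * CARD('n) elements, so real ^ ('n + 'n) plays the role
   of R^(2M) when CARD('n) = M; Inl indexes the first block, Inr the second.
   Note that * and ^ act entrywise on type vec; matrix products are written **. *)

definition block_vec :: "real ^ 'm \<Rightarrow> real ^ 'n \<Rightarrow> real ^ ('m + 'n)"
  where "block_vec a b = (\<chi> i. case i of Inl r \<Rightarrow> a $ r | Inr r \<Rightarrow> b $ r)"

definition block_mat ::
  "real ^ 'n ^ 'm \<Rightarrow> real ^ 'q ^ 'm \<Rightarrow> real ^ 'n ^ 'p \<Rightarrow> real ^ 'q ^ 'p
    \<Rightarrow> real ^ ('n + 'q) ^ ('m + 'p)"
  where "block_mat A B C D =
    (\<chi> i j. case i of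
        Inl r \<Rightarrow> (case j of Inl c \<Rightarrow> A $ r $ c | Inr c \<Rightarrow> B $ r $ c)
      | Inr r \<Rightarrow> (case j of Inl c \<Rightarrow> C $ r $ c | Inr c \<Rightarrow> D $ r $ c))"

definition pos_semidef :: "real ^ 'n ^ 'n \<Rightarrow> bool"
  where "pos_semidef H \<longleftrightarrow> transpose H = H \<and> (\<forall>x. 0 \<le> x \<bullet> (H *v x))"

definition pos_def :: "real ^ 'n ^ 'n \<Rightarrow> bool"
  where "pos_def H \<longleftrightarrow> transpose H = H \<and> (\<forall>x. x \<noteq> 0 \<longrightarrow> 0 < x \<bullet> (H *v x))"

(* Intended for positive semidefinite H, where the described matrix exists uniquely. *)
definition psd_sqrt :: "real ^ 'n ^ 'n \<Rightarrow> real ^ 'n ^ 'n"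
  where "psd_sqrt H = (THE S. pos_semidef S \<and> S ** S = H)"

definition krylov_space :: "real ^ 'n ^ 'n \<Rightarrow> real ^ 'n \<Rightarrow> nat \<Rightarrow> (real ^ 'n) set"
  where "krylov_space B v k = span {(((*v) B) ^^ j) v | j. j < k}"

definition minres_residual_norm ::
  "real ^ 'n ^ 'n \<Rightarrow> real ^ 'n ^ 'n \<Rightarrow> real ^ 'n \<Rightarrow> real ^ 'n \<Rightarrow> real"
  where "minres_residual_norm A P y x =
    sqrt ((y - A *v x) \<bullet> (matrix_inv P *v (y - A *v x)))"

(* The k-th iterate in exact arithmetic for A x = y with preconditioner P and initial
   guess x0.  For symmetric nonsingular A and positive definite P the minimizer is unique,
   so the choice made by arg_min is immaterial. *)
definition minres_iterate ::
  "real ^ 'n ^ 'n \<Rightarrow> real ^ 'n ^ 'n \<Rightarrow> real ^ 'n \<Rightarrow> real ^ 'n \<Rightarrow> nat \<Rightarrow> real ^ 'n"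
  where "minres_iterate A P y x0 k =
    arg_min_on (minres_residual_norm A P y)
      ((+) x0 ` krylov_space (matrix_inv P ** A) (matrix_inv P *v (y - A *v x0)) k)"

definition saddle_mat :: "real \<Rightarrow> real \<Rightarrow> real ^ 'n ^ 'n \<Rightarrow> real ^ ('n + 'n) ^ ('n + 'n)"
  where "saddle_mat \<alpha> \<beta> K =
    block_mat (\<beta> *\<^sub>R mat 1) (K + \<alpha> *\<^sub>R mat 1)
              (K + \<alpha> *\<^sub>R mat 1) (- \<beta> *\<^sub>R mat 1)"

definition saddle_precond :: "real \<Rightarrow> real \<Rightarrow> real ^ 'n ^ 'n \<Rightarrow> real ^ ('n + 'n) ^ ('n + 'n)"
  where "saddle_precond \<alpha> \<beta> K =
    (let S = psd_sqrt ((K + \<alpha> *\<^sub>R mat 1) ** (K + \<alpha> *\<^sub>R mat 1) + \<beta>\<^sup>2 *\<^sub>R mat 1)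
     in block_mat S 0 0 S)"

end

theory Submission
  imports Defs
begin

text \<open>
  Write \<open>B = K + \<alpha> I\<close>, \<open>H = B\<^sup>2 + \<beta>\<^sup>2 I\<close> and \<open>S = \<surd>H\<close>. Multiplying out the blocks shows that
  the square of the saddle point matrix \<open>\<A>\<close> is block diagonal with both blocks equal to \<open>H\<close>, so
  the preconditioner \<open>P\<close>, with both blocks equal to \<open>S\<close>, satisfies \<open>P\<^sup>2 = \<A>\<^sup>2\<close>. As \<open>S\<close> is a
  function of \<open>B\<close>, it commutes with \<open>B\<close>, and hence \<open>P\<close> commutes with \<open>\<A>\<close>.
  Therefore \<open>(P\<^sup>-\<^sup>1 \<A>)\<^sup>2 = I\<close>: the preconditioned matrix has only the eigenvalues 1 and -1.

  It follows that the correction \<open>\<A>\<^sup>-\<^sup>1 r\<close> that carries the initial guess, with residual \<open>r\<close>,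
  to the solution is \<open>P\<^sup>-\<^sup>1 \<A> (P\<^sup>-\<^sup>1 r)\<close>, the second generator of the Krylov space.
  Over the second affine Krylov space the least residual norm is thus zero, and since
  \<open>P\<^sup>-\<^sup>1\<close> is positive definite, a minimizer has residual zero. This is the lemma
  \<open>minres_two_steps\<close>.

  What remains is that the positive semidefinite square root exists, is unique, and commutes with
  \<open>B\<close>. All three come from an orthonormal basis of eigenvectors of a symmetric matrix
  (\<open>symmetric_matrix_orthonormal_eigenbasis\<close>) together with the observation that a
  positive semidefinite \<open>T\<close> with \<open>T\<^sup>2 e = \<mu> e\<close> must satisfy \<open>T e = \<surd>\<mu> e\<close>
  (\<open>pos_semidef_square_eigenvector\<close>).
\<close>

section \<open>Symmetric and semidefinite matrices\<close>

lemma symmetric_matrix_inner: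
  fixes A :: "real ^ 'n ^ 'n"
  assumes "transpose A = A"
  shows "x \<bullet> (A *v y) = (A *v x) \<bullet> y"
  by (metis assms dot_lmul_matrix transpose_matrix_vector)

lemma symmetric_matrix_from_inner:
  fixes A :: "real ^ 'n ^ 'n"
  assumes "\<And>x y. x \<bullet> (A *v y) = (A *v x) \<bullet> y"
  shows "transpose A = A"
  unfolding matrix_eq
proof
  fix x
  have "(transpose A *v x) \<bullet> y = (A *v x) \<bullet> y" for y
    using assms[of x y] by (simp add: dot_lmul_matrix)
  then show "transpose A *v x = A *v x"
    by (metis vector_eq_rdot)
qed

text \<open>
  If \<open>v\<close> minimizes a quadratic form on an invariant subspace with value zero, the gradient there
  vanishes: along the direction of \<open>A v\<close> itself, the form would otherwise become negative to first
  order. The subspace is needed for the eigenvector argument below; with the whole space the lemma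
  says that the isotropic vectors of a semidefinite form lie in the kernel.
\<close>

lemma semidefinite_on_subspace_kernel:
  fixes A :: "real ^ 'n ^ 'n"
  assumes sym: "transpose A = A"
    and W: "subspace W" and inv: "\<And>x. x \<in> W \<Longrightarrow> A *v x \<in> W"
    and nonneg: "\<And>x. x \<in> W \<Longrightarrow> 0 \<le> x \<bullet> (A *v x)"
    and v: "v \<in> W" "v \<bullet> (A *v v) = 0"
  shows "A *v v = 0"
proof (rule ccontr)
  assume nz: "A *v v \<noteq> 0"
  define w where "w = A *v v"
  define q where "q = w \<bullet> w"
  define c where "c = w \<bullet> (A *v w)"
  have q: "q > 0" using nz by (simp add: q_def w_def)
  have w: "w \<in> W" using inv v(1) by (simp add: w_def)
  have c: "c \<ge> 0" using nonneg[OF w] by (simp add: c_def)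
  \<comment> \<open>A step so short that the second-order term \<open>t\<^sup>2 c\<close> stays below the first-order gain \<open>2 t q\<close>.\<close>
  define t where "t = q / (c + 1)"
  have t: "t > 0" using q c by (simp add: t_def)
  have "v - t *\<^sub>R w \<in> W"
    using W v(1) w by (simp add: subspace_diff subspace_scale)
  then have "0 \<le> (v - t *\<^sub>R w) \<bullet> (A *v (v - t *\<^sub>R w))"
    by (rule nonneg)
  also have "\<dots> = v \<bullet> (A *v v) - t * (v \<bullet> (A *v w)) - t * (w \<bullet> (A *v v)) + t * t * c"
    by (simp add: c_def matrix_vector_mult_diff_distrib matrix_vector_mult_scaleR algebra_simps)
  also have "\<dots> = t * (t * c - 2 * q)"
    using symmetric_matrix_inner[OF sym, of v w] v(2)
    by (simp add: q_def w_def[symmetric] algebra_simps)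
  finally have "2 * q \<le> t * c"
    using t by (simp add: zero_le_mult_iff)
  moreover have "t * c \<le> q"
    using q c by (simp add: t_def field_simps)
  ultimately show False using q by linarith
qed

lemma pos_semidef_invertible_imp_pos_def:
  fixes H :: "real ^ 'n ^ 'n"
  assumes H: "pos_semidef H" and inv: "invertible H"
  shows "pos_def H"
  unfolding pos_def_def
proof (intro conjI allI impI)
  show sym: "transpose H = H" using H by (simp add: pos_semidef_def)
  fix x :: "real ^ 'n"
  assume "x \<noteq> 0"
  then have "H *v x \<noteq> 0"
    using inj_matrix_vector_mult[OF inv] by (metis injD matrix_vector_mult_0_right)
  then have "x \<bullet> (H *v x) \<noteq> 0"
    using semidefinite_on_subspace_kernel[OF sym, of UNIV x] H by (auto simp: pos_semidef_def)
  then show "0 < x \<bullet> (H *v x)"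
    using H by (simp add: pos_semidef_def less_le)
qed

lemma pos_def_imp_invertible:
  fixes H :: "real ^ 'n ^ 'n"
  assumes "pos_def H"
  shows "invertible H"
proof -
  have "\<forall>x. H *v x = 0 \<longrightarrow> x = 0"
    using assms unfolding pos_def_def by force
  then show ?thesis
    by (simp add: invertible_left_inverse matrix_left_invertible_ker)
qed

lemma matrix_inv_mult:
  fixes A :: "real ^ 'n ^ 'n"
  assumes "invertible A"
  shows "A *v (matrix_inv A *v x) = x" "matrix_inv A *v (A *v x) = x"
proof -
  have "A ** matrix_inv A = mat 1 \<and> matrix_inv A ** A = mat 1"
    using assms unfolding invertible_def matrix_inv_def by (rule someI_ex)
  then show "A *v (matrix_inv A *v x) = x" "matrix_inv A *v (A *v x) = x"
    by (simp_all add: matrix_vector_mul_assoc)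
qed

section \<open>Spectral theorem\<close>

text \<open>
  The Rayleigh quotient attains its maximum \<open>\<mu>\<close> on the unit sphere of the subspace, say at \<open>v\<close>.
  Then \<open>\<mu> I - A\<close> is semidefinite on the subspace with \<open>v\<close> isotropic, so \<open>v\<close> lies in its
  kernel.
\<close>

lemma symmetric_matrix_eigenvector_in_subspace:
  fixes A :: "real ^ 'n ^ 'n"
  assumes sym: "transpose A = A"
    and W: "subspace W" and inv: "\<And>x. x \<in> W \<Longrightarrow> A *v x \<in> W"
    and nontriv: "W \<noteq> {0}"
  obtains v \<mu> where "v \<in> W" "norm v = 1" "A *v v = \<mu> *\<^sub>R v"
proof -
  obtain u where u: "u \<in> W" "u \<noteq> 0"
    using nontriv subspace_0[OF W] by auto
  have ne: "sphere 0 1 \<inter> W \<noteq> {}"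
  proof -
    have "(1 / norm u) *\<^sub>R u \<in> sphere 0 1 \<inter> W"
      using u W by (simp add: subspace_scale)
    then show ?thesis by blast
  qed
  have "compact (sphere 0 1 \<inter> W)"
    using W by (simp add: closed_subspace compact_Int_closed)
  moreover have "continuous_on (sphere 0 1 \<inter> W) (\<lambda>x. x \<bullet> (A *v x))"
    by (intro continuous_intros linear_continuous_on) simp
  ultimately have "\<exists>v\<in>sphere 0 1 \<inter> W. \<forall>y\<in>sphere 0 1 \<inter> W. y \<bullet> (A *v y) \<le> v \<bullet> (A *v v)"
    using ne by (intro continuous_attains_sup)
  then obtain v where v: "v \<in> sphere 0 1 \<inter> W"
    and max: "\<And>y. y \<in> sphere 0 1 \<inter> W \<Longrightarrow> y \<bullet> (A *v y) \<le> v \<bullet> (A *v v)"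
    by blast
  define \<mu> where "\<mu> = v \<bullet> (A *v v)"
  define N where "N = \<mu> *\<^sub>R mat 1 - A"
  have N: "N *v x = \<mu> *\<^sub>R x - A *v x" for x
    by (simp add: N_def matrix_vector_mult_diff_rdistrib scaleR_matrix_vector_assoc[symmetric])
  have "N *v v = 0"
  proof (rule semidefinite_on_subspace_kernel[OF _ W])
    show "transpose N = N"
      by (rule symmetric_matrix_from_inner)
        (simp add: N symmetric_matrix_inner[OF sym] inner_diff_left inner_diff_right)
    show "N *v x \<in> W" if "x \<in> W" for x
      using that inv W by (simp add: N subspace_diff subspace_scale)
    show "v \<in> W" using v by simp
    show "v \<bullet> (N *v v) = 0"
      using v by (simp add: N inner_diff_right \<mu>_def dot_square_norm)
    show "0 \<le> x \<bullet> (N *v x)" if x: "x \<in> W" for x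
    proof (cases "x = 0")
      case False
      define y where "y = (1 / norm x) *\<^sub>R x"
      have x_eq: "x = norm x *\<^sub>R y" using False by (simp add: y_def)
      have "y \<in> sphere 0 1 \<inter> W"
        using False x W by (simp add: y_def subspace_scale)
      then have "y \<bullet> (A *v y) \<le> \<mu>" unfolding \<mu>_def by (rule max)
      then have "(norm x)\<^sup>2 * (y \<bullet> (A *v y)) \<le> (norm x)\<^sup>2 * \<mu>"
        by (simp add: mult_left_mono)
      moreover have "x \<bullet> (A *v x) = (norm x)\<^sup>2 * (y \<bullet> (A *v y))"
        by (subst (1 2) x_eq) (simp add: matrix_vector_mult_scaleR power2_eq_square)
      ultimately show ?thesis
        by (simp add: N inner_diff_right dot_square_norm mult.commute)
    qed simp
  qed
  then show thesis
    using that[of v \<mu>] v by (simp add: N)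
qed

text \<open>
  An orthonormal set of eigenvectors of maximal cardinality spans: its orthogonal complement is
  invariant, so if it were nontrivial it would contain a further eigenvector.
\<close>

theorem symmetric_matrix_orthonormal_eigenbasis:
  fixes A :: "real ^ 'n ^ 'n"
  assumes sym: "transpose A = A"
  obtains E \<mu> where "finite E" "pairwise orthogonal E" "\<And>e. e \<in> E \<Longrightarrow> norm e = 1"
    "\<And>e. e \<in> E \<Longrightarrow> A *v e = \<mu> e *\<^sub>R e" "span E = UNIV"
proof -
  define good where "good E \<longleftrightarrow> pairwise orthogonal E \<and>
    (\<forall>e\<in>E. norm e = 1 \<and> (\<exists>\<mu>. A *v e = \<mu> *\<^sub>R e))" for E
  have bound: "finite E \<and> card E \<le> DIM(real ^ 'n)" if "good E" for E
  proof (rule independent_bound, rule pairwise_orthogonal_independent)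
    show "pairwise orthogonal E" "0 \<notin> E"
      using that by (auto simp: good_def)
  qed
  have "good {}" by (simp add: good_def)
  then obtain E where E: "good E" and max: "\<And>F. good F \<Longrightarrow> card F \<le> card E"
    using ex_has_greatest_nat[of good "{}" card "Suc DIM(real ^ 'n)"] bound
    by (auto simp: less_Suc_eq_le)
  obtain \<mu> where \<mu>: "\<And>e. e \<in> E \<Longrightarrow> A *v e = \<mu> e *\<^sub>R e"
    using E unfolding good_def by metis
  have fin: "finite E" using bound[OF E] by simp
  define W where "W = {x. \<forall>e\<in>E. x \<bullet> e = 0}"
  have W: "subspace W"
    by (auto simp: W_def subspace_def inner_add_left)
  have inv: "A *v x \<in> W" if "x \<in> W" for x
    using that by (auto simp: W_def symmetric_matrix_inner[OF sym, symmetric] \<mu>)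
  have trivial: "W = {0}"
  proof (rule ccontr)
    assume "W \<noteq> {0}"
    then obtain v \<nu> where v: "v \<in> W" "norm v = 1" "A *v v = \<nu> *\<^sub>R v"
      using symmetric_matrix_eigenvector_in_subspace[OF sym W inv] by blast
    have "v \<notin> E" using v(1,2) by (auto simp: W_def dot_square_norm)
    moreover have "good (insert v E)"
      using E v unfolding good_def W_def
      by (auto simp: pairwise_insert orthogonal_def inner_commute)
    then have "card (insert v E) \<le> card E" by (rule max)
    ultimately show False using fin by simp
  qed
  have "x \<in> span E" for x
  proof -
    obtain y z where y: "y \<in> span E" and z: "\<And>w. w \<in> span E \<Longrightarrow> orthogonal z w"
      and x: "x = y + z"
      using orthogonal_subspace_decomp_exists[of E x] by blast
    have "z \<in> W" using z by (auto simp: W_def orthogonal_def span_base)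
    then show ?thesis using x y trivial by simp
  qed
  then show thesis
    using that[of E \<mu>] fin \<mu> E by (auto simp: good_def)
qed

section \<open>The positive semidefinite square root\<close>

text \<open>
  With \<open>s = \<surd>\<mu>\<close>, the vector \<open>y = T e - s e\<close> satisfies \<open>T y = - s y\<close>. As \<open>T\<close> has no negative
  eigenvalue, \<open>y = 0\<close> if \<open>s\<close> is positive; if \<open>s = 0\<close> then \<open>T e\<close> is annihilated because its squared
  norm is \<open>e \<bullet> T\<^sup>2 e = 0\<close>.
\<close>

lemma pos_semidef_square_eigenvector:
  fixes T :: "real ^ 'n ^ 'n"
  assumes T: "pos_semidef T" and ev: "(T ** T) *v e = \<mu> *\<^sub>R e" and "0 \<le> \<mu>"
  shows "T *v e = sqrt \<mu> *\<^sub>R e"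
proof (cases "\<mu> = 0")
  case True
  have "(T *v e) \<bullet> (T *v e) = e \<bullet> (T *v (T *v e))"
    using T by (simp add: symmetric_matrix_inner pos_semidef_def)
  also have "\<dots> = 0"
    using ev True by (simp add: matrix_vector_mul_assoc)
  finally show ?thesis using True by simp
next
  case False
  define s where "s = sqrt \<mu>"
  have s: "s > 0" "s * s = \<mu>"
    using False \<open>0 \<le> \<mu>\<close> by (simp_all add: s_def)
  define y where "y = T *v e - s *\<^sub>R e"
  have "T *v y = - s *\<^sub>R y"
    using ev by (simp add: y_def matrix_vector_mult_diff_distrib matrix_vector_mult_scaleR
        matrix_vector_mul_assoc s(2)[symmetric] scaleR_diff_right)
  moreover have "0 \<le> y \<bullet> (T *v y)"
    using T by (simp add: pos_semidef_def)
  ultimately have "0 \<le> - s * (y \<bullet> y)" by simp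
  then have "y \<bullet> y \<le> 0"
    using s(1) by (simp add: mult_le_0_iff)
  then have "y = 0"
    by (metis inner_gt_zero_iff not_less)
  then show ?thesis by (simp add: y_def s_def)
qed

lemma pos_semidef_eigenvalue_nonneg:
  fixes H :: "real ^ 'n ^ 'n"
  assumes "pos_semidef H" "H *v e = \<mu> *\<^sub>R e" "e \<noteq> 0"
  shows "0 \<le> \<mu>"
proof -
  have "0 \<le> e \<bullet> (H *v e)"
    using assms(1) by (simp add: pos_semidef_def)
  then have "0 \<le> \<mu> * (e \<bullet> e)"
    by (simp add: assms(2))
  then show ?thesis
    using assms(3) inner_gt_zero_iff[of e] by (simp add: zero_le_mult_iff not_le[symmetric])
qed

lemma matrix_eq_on_spanning_set:
  fixes A B :: "real ^ 'n ^ 'n"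
  assumes "span E = UNIV" and "\<And>e. e \<in> E \<Longrightarrow> A *v e = B *v e"
  shows "A = B"
  unfolding matrix_eq
proof
  fix x
  show "A *v x = B *v x"
    using linear_eq_on_span[OF matrix_vector_mul_linear matrix_vector_mul_linear assms(2), of E x]
    by (simp add: assms(1))
qed

text \<open>
  In an orthonormal eigenbasis, taking square roots of the eigenvalues defines a root. Any other
  root has to agree with it on this basis, since it maps every \<open>e\<close> in it to \<open>\<surd>\<mu> e\<close>.
\<close>

theorem pos_semidef_ex1_sqrt:
  fixes H :: "real ^ 'n ^ 'n"
  assumes H: "pos_semidef H"
  shows "\<exists>!S. pos_semidef S \<and> S ** S = H"
proof -
  have "transpose H = H" using H by (simp add: pos_semidef_def)
  then obtain E \<mu> where E: "finite E" "pairwise orthogonal E" "\<And>e. e \<in> E \<Longrightarrow> norm e = 1"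
    and \<mu>: "\<And>e. e \<in> E \<Longrightarrow> H *v e = \<mu> e *\<^sub>R e" and span: "span E = UNIV"
    using symmetric_matrix_orthonormal_eigenbasis by blast
  have nonneg: "0 \<le> \<mu> e" if "e \<in> E" for e
  proof (rule pos_semidef_eigenvalue_nonneg[OF H \<mu>[OF that]])
    show "e \<noteq> 0" using E(3)[OF that] by auto
  qed
  define f where "f x = (\<Sum>e\<in>E. (sqrt (\<mu> e) * (e \<bullet> x)) *\<^sub>R e)" for x
  have "linear f"
    by (rule linearI) (simp_all add: f_def inner_add_right algebra_simps sum.distrib
        scaleR_sum_right)
  then have f: "matrix f *v x = f x" for x
    by (simp add: matrix_works)
  have sym: "x \<bullet> f y = f x \<bullet> y" for x y
    by (simp add: f_def inner_sum_left inner_sum_right inner_commute mult_ac)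
  have psd: "pos_semidef (matrix f)"
    unfolding pos_semidef_def
  proof (intro conjI allI)
    show "transpose (matrix f) = matrix f"
      by (rule symmetric_matrix_from_inner) (simp add: f sym)
    show "0 \<le> x \<bullet> (matrix f *v x)" for x
    proof -
      have "x \<bullet> f x = (\<Sum>e\<in>E. sqrt (\<mu> e) * (e \<bullet> x)\<^sup>2)"
        by (simp add: f_def inner_sum_right inner_commute power2_eq_square mult.assoc)
      then show ?thesis
        by (simp add: f sum_nonneg nonneg)
    qed
  qed
  have fe: "f e = sqrt (\<mu> e) *\<^sub>R e" if e: "e \<in> E" for e
  proof -
    have "f e = (\<Sum>d\<in>E. if d = e then sqrt (\<mu> e) *\<^sub>R e else 0)"
      unfolding f_def
    proof (rule sum.cong[OF refl])
      fix d
      assume d: "d \<in> E"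
      show "(sqrt (\<mu> d) * (d \<bullet> e)) *\<^sub>R d = (if d = e then sqrt (\<mu> e) *\<^sub>R e else 0)"
        using d e E(2,3) by (auto simp: pairwise_def orthogonal_def dot_square_norm)
    qed
    also have "\<dots> = sqrt (\<mu> e) *\<^sub>R e" using E(1) e by simp
    finally show ?thesis .
  qed
  show ?thesis
  proof (rule ex1I[of _ "matrix f"])
    have "matrix f ** matrix f = H"
    proof (rule matrix_eq_on_spanning_set[OF span])
      show "(matrix f ** matrix f) *v e = H *v e" if e: "e \<in> E" for e
        using nonneg[OF e] linear_scale[OF \<open>linear f\<close>]
        by (simp add: matrix_vector_mul_assoc[symmetric] f fe[OF e] \<mu>[OF e])
    qed
    with psd show "pos_semidef (matrix f) \<and> matrix f ** matrix f = H" by simp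
  next
    fix T
    assume T: "pos_semidef T \<and> T ** T = H"
    show "T = matrix f"
    proof (rule matrix_eq_on_spanning_set[OF span])
      show "T *v e = matrix f *v e" if e: "e \<in> E" for e
        using pos_semidef_square_eigenvector[of T e "\<mu> e"] T \<mu>[OF e] nonneg[OF e]
        by (simp add: f fe[OF e])
    qed
  qed
qed

lemma psd_sqrt:
  fixes H :: "real ^ 'n ^ 'n"
  assumes "pos_semidef H"
  shows pos_semidef_psd_sqrt: "pos_semidef (psd_sqrt H)"
    and psd_sqrt_square: "psd_sqrt H ** psd_sqrt H = H"
  using theI'[OF pos_semidef_ex1_sqrt[OF assms]] by (simp_all add: psd_sqrt_def)

text \<open>
  An eigenvector of \<open>B\<close> is one of \<open>H = B\<^sup>2 + \<beta>\<^sup>2 I\<close> and therefore of \<open>\<surd>H\<close>. So \<open>B\<close> and \<open>\<surd>H\<close> are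
  diagonal in a common basis.
\<close>

lemma psd_sqrt_shifted_square_commute:
  fixes B :: "real ^ 'n ^ 'n" and \<beta> :: real
  defines "H \<equiv> B ** B + \<beta>\<^sup>2 *\<^sub>R mat 1"
  assumes sym: "transpose B = B"
  shows "pos_semidef H" and "psd_sqrt H ** B = B ** psd_sqrt H"
proof -
  have H: "H *v x = B *v (B *v x) + \<beta>\<^sup>2 *\<^sub>R x" for x
    by (simp add: H_def matrix_vector_mult_add_rdistrib matrix_vector_mul_assoc
        scaleR_matrix_vector_assoc[symmetric])
  show psd: "pos_semidef H"
    unfolding pos_semidef_def
  proof (intro conjI allI)
    show "transpose H = H"
      by (rule symmetric_matrix_from_inner)
        (simp add: H symmetric_matrix_inner[OF sym] inner_add_left inner_add_right)
    show "0 \<le> x \<bullet> (H *v x)" for x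
      by (simp add: H inner_add_right symmetric_matrix_inner[OF sym, of x])
  qed
  obtain E \<mu> where "finite E" "pairwise orthogonal E" "\<And>e. e \<in> E \<Longrightarrow> norm e = 1"
    and \<mu>: "\<And>e. e \<in> E \<Longrightarrow> B *v e = \<mu> e *\<^sub>R e" and span: "span E = UNIV"
    by (rule symmetric_matrix_orthonormal_eigenbasis[OF sym]) metis
  show "psd_sqrt H ** B = B ** psd_sqrt H"
  proof (rule matrix_eq_on_spanning_set[OF span])
    fix e
    assume e: "e \<in> E"
    have "H *v e = ((\<mu> e)\<^sup>2 + \<beta>\<^sup>2) *\<^sub>R e"
      by (simp add: H \<mu>[OF e] matrix_vector_mult_scaleR scaleR_left_distrib power2_eq_square)
    then have "psd_sqrt H *v e = sqrt ((\<mu> e)\<^sup>2 + \<beta>\<^sup>2) *\<^sub>R e"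
      by (intro pos_semidef_square_eigenvector) (simp_all add: psd_sqrt[OF psd])
    then show "(psd_sqrt H ** B) *v e = (B ** psd_sqrt H) *v e"
      by (simp add: matrix_vector_mul_assoc[symmetric] \<mu>[OF e] matrix_vector_mult_scaleR)
  qed
qed

section \<open>Block matrices\<close>

lemma block_vec_cases:
  fixes x :: "real ^ ('m::finite + 'n::finite)"
  obtains u v where "x = block_vec u v"
proof
  show "x = block_vec (\<chi> i. x $ Inl i) (\<chi> i. x $ Inr i)"
    by (auto simp: block_vec_def vec_eq_iff split: sum.split)
qed

lemma sum_UNIV_sum_type:
  fixes f :: "'m::finite + 'n::finite \<Rightarrow> real"
  shows "sum f UNIV = (\<Sum>i\<in>UNIV. f (Inl i)) + (\<Sum>i\<in>UNIV. f (Inr i))"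
  using sum.Plus[of "UNIV :: 'm set" "UNIV :: 'n set" f] by (simp add: o_def)

lemma block_mat_mult_block_vec:
  "block_mat A B C D *v block_vec x y = block_vec (A *v x + B *v y) (C *v x + D *v y)"
  by (auto simp: vec_eq_iff matrix_vector_mult_def block_mat_def block_vec_def sum_UNIV_sum_type
      split: sum.split)

lemma inner_block_vec: "block_vec a b \<bullet> block_vec c d = a \<bullet> c + b \<bullet> d"
  by (simp add: inner_vec_def block_vec_def sum_UNIV_sum_type)

lemma pos_semidef_block_diagonal:
  assumes "pos_semidef S" "pos_semidef T"
  shows "pos_semidef (block_mat S 0 0 T)"
  unfolding pos_semidef_def
proof (intro conjI allI)
  show "transpose (block_mat S 0 0 T) = block_mat S 0 0 T"
  proof (rule symmetric_matrix_from_inner)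
    fix x y
    show "x \<bullet> (block_mat S 0 0 T *v y) = (block_mat S 0 0 T *v x) \<bullet> y"
      using assms
      by (cases x rule: block_vec_cases, cases y rule: block_vec_cases)
        (simp add: block_mat_mult_block_vec inner_block_vec pos_semidef_def symmetric_matrix_inner)
  qed
  fix x
  show "0 \<le> x \<bullet> (block_mat S 0 0 T *v x)"
    using assms
    by (cases x rule: block_vec_cases)
      (simp add: block_mat_mult_block_vec inner_block_vec pos_semidef_def)
qed

section \<open>Two-step termination of MINRES\<close>

text \<open>
  A solution in the affine Krylov space has residual norm zero, so the minimal residual norm is zero.
  Since the inverse of \<open>P\<close> is positive definite, every minimizer then has residual zero.
\<close>

lemma minres_iterate_exact:
  fixes A P :: "real ^ 'n ^ 'n"
  assumes P: "pos_def P"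
    and z: "z \<in> (+) x0 ` krylov_space (matrix_inv P ** A) (matrix_inv P *v (y - A *v x0)) k"
    and sol: "A *v z = y"
  shows "A *v minres_iterate A P y x0 k = y"
proof -
  note inv = matrix_inv_mult[OF pos_def_imp_invertible[OF P]]
  \<comment> \<open>Substituting \<open>w = P u\<close> reduces definiteness of the inverse to that of \<open>P\<close>.\<close>
  have quad: "w \<bullet> (matrix_inv P *v w) = (matrix_inv P *v w) \<bullet> (P *v (matrix_inv P *v w))" for w
    by (simp add: inv inner_commute)
  have nonneg: "0 \<le> w \<bullet> (matrix_inv P *v w)" for w
  proof (cases "matrix_inv P *v w = 0")
    case False
    then show ?thesis using P unfolding quad[of w] pos_def_def by (intro less_imp_le) simp
  qed simp
  have definite: "w = 0" if "w \<bullet> (matrix_inv P *v w) \<le> 0" for w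
  proof -
    have "matrix_inv P *v w = 0"
      using that P unfolding quad[of w] pos_def_def not_less[symmetric] by blast
    then show ?thesis using inv(1)[of w] by simp
  qed
  have norm_z: "minres_residual_norm A P y z = 0"
    by (simp add: minres_residual_norm_def sol)
  show ?thesis
    unfolding minres_iterate_def arg_min_on_def
  proof (rule arg_minI[where x = z])
    show "\<not> minres_residual_norm A P y x < minres_residual_norm A P y z" for x
      unfolding norm_z by (simp add: minres_residual_norm_def nonneg not_less)
  next
    fix x
    assume "\<forall>w. w \<in> (+) x0 ` krylov_space (matrix_inv P ** A) (matrix_inv P *v (y - A *v x0)) k
      \<longrightarrow> \<not> minres_residual_norm A P y w < minres_residual_norm A P y x"
    then have "minres_residual_norm A P y x \<le> 0"
      using z norm_z by force
    then have "y - A *v x = 0"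
      by (intro definite) (simp add: minres_residual_norm_def)
    then show "A *v x = y" by simp
  qed (rule z)
qed

text \<open>
  The hypotheses make \<open>M = P\<^sup>-\<^sup>1 A\<close> an involution. Hence \<open>M\<^sup>-\<^sup>1 = M\<close>, and the error of the initial
  guess, \<open>A\<^sup>-\<^sup>1 r = M\<^sup>-\<^sup>1 (P\<^sup>-\<^sup>1 r)\<close>, is the Krylov vector \<open>M (P\<^sup>-\<^sup>1 r)\<close>.
\<close>

theorem minres_two_steps:
  fixes A P :: "real ^ 'n ^ 'n"
  assumes P: "pos_def P" and comm: "P ** A = A ** P" and square: "P ** P = A ** A"
  shows "A *v minres_iterate A P y x0 2 = y"
proof (rule minres_iterate_exact[OF P])
  note inv = matrix_inv_mult[OF pos_def_imp_invertible[OF P]]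
  define Q where "Q = matrix_inv P"
  define r where "r = y - A *v x0"
  define d where "d = Q *v (A *v (Q *v r))"
  have "((*v) (Q ** A) ^^ 1) (Q *v r) = d"
    by (simp add: d_def matrix_vector_mul_assoc[symmetric])
  then have "d \<in> krylov_space (Q ** A) (Q *v r) 2"
    unfolding krylov_space_def by (intro span_base CollectI exI[of _ 1]) simp
  then show "x0 + d \<in> (+) x0 ` krylov_space (matrix_inv P ** A)
      (matrix_inv P *v (y - A *v x0)) 2"
    by (simp add: Q_def r_def)
  have comm_inv: "A *v (Q *v u) = Q *v (A *v u)" for u
  proof -
    have "P *v (A *v (Q *v u)) = A *v (P *v (Q *v u))"
      using arg_cong[OF comm, of "\<lambda>M. M *v (Q *v u)"]
      by (simp add: matrix_vector_mul_assoc[symmetric])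
    then have "P *v (A *v (Q *v u)) = A *v u"
      by (simp add: Q_def inv)
    then have "Q *v (A *v u) = Q *v (P *v (A *v (Q *v u)))"
      by (rule arg_cong[OF sym])
    then show ?thesis by (simp add: Q_def inv)
  qed
  have "A *v d = Q *v (A *v (A *v (Q *v r)))"
    by (simp add: d_def comm_inv)
  also have "\<dots> = Q *v (P *v (P *v (Q *v r)))"
    using arg_cong[OF square, of "\<lambda>M. Q *v (M *v (Q *v r))"]
    by (simp add: matrix_vector_mul_assoc[symmetric])
  also have "\<dots> = r"
    by (simp add: Q_def inv)
  finally show "A *v (x0 + d) = y"
    by (simp add: matrix_vector_right_distrib r_def)
qed

section \<open>The saddle point system\<close>

text \<open>
  In the square of the saddle point matrix, the off-diagonal blocks \<open>\<beta> B - \<beta> B\<close> cancel, because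
  the diagonal blocks are opposite multiples of the identity; this leaves the square of the
  preconditioner.
\<close>

lemma saddle_precond_properties:
  fixes K :: "real ^ 'm ^ 'm"
  assumes sym: "transpose K = K"
  shows pos_semidef_saddle_precond: "pos_semidef (saddle_precond \<alpha> \<beta> K)"
    and saddle_precond_commute:
      "saddle_precond \<alpha> \<beta> K ** saddle_mat \<alpha> \<beta> K = saddle_mat \<alpha> \<beta> K ** saddle_precond \<alpha> \<beta> K"
    and saddle_precond_square:
      "saddle_precond \<alpha> \<beta> K ** saddle_precond \<alpha> \<beta> K = saddle_mat \<alpha> \<beta> K ** saddle_mat \<alpha> \<beta> K"
proof -
  define B where "B = K + \<alpha> *\<^sub>R mat 1"
  define H where "H = B ** B + \<beta>\<^sup>2 *\<^sub>R mat 1"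
  define S where "S = psd_sqrt H"
  have "transpose B = B"
    by (rule symmetric_matrix_from_inner)
      (simp add: B_def matrix_vector_mult_add_rdistrib scaleR_matrix_vector_assoc[symmetric]
        inner_add_left inner_add_right symmetric_matrix_inner[OF sym])
  note root = psd_sqrt_shifted_square_commute[OF this, of \<beta>, folded H_def]
  have commute: "S *v (B *v x) = B *v (S *v x)" for x
    using root(2) by (simp add: matrix_vector_mul_assoc S_def)
  have S_square: "S *v (S *v x) = B *v (B *v x) + \<beta>\<^sup>2 *\<^sub>R x" for x
    by (simp add: matrix_vector_mul_assoc S_def psd_sqrt_square[OF root(1)])
      (simp add: H_def matrix_vector_mult_add_rdistrib scaleR_matrix_vector_assoc[symmetric])
  have precond: "saddle_precond \<alpha> \<beta> K = block_mat S 0 0 S"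
    by (simp add: saddle_precond_def S_def H_def B_def Let_def)
  have neg: "- (\<beta> *\<^sub>R mat 1) *v v = - (\<beta> *\<^sub>R v)" for v :: "real ^ 'm"
    using scaleR_matrix_vector_assoc[of "- \<beta>" "mat 1" v] by simp
  have saddle: "saddle_mat \<alpha> \<beta> K *v block_vec u v =
      block_vec (\<beta> *\<^sub>R u + B *v v) (B *v u - \<beta> *\<^sub>R v)" for u v
    by (simp add: neg saddle_mat_def B_def[symmetric] block_mat_mult_block_vec
        scaleR_matrix_vector_assoc[symmetric])
  show "pos_semidef (saddle_precond \<alpha> \<beta> K)"
    unfolding precond
    by (intro pos_semidef_block_diagonal) (simp_all add: S_def pos_semidef_psd_sqrt root(1))
  show "saddle_precond \<alpha> \<beta> K ** saddle_mat \<alpha> \<beta> K =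
      saddle_mat \<alpha> \<beta> K ** saddle_precond \<alpha> \<beta> K"
    unfolding matrix_eq
  proof
    fix x
    show "(saddle_precond \<alpha> \<beta> K ** saddle_mat \<alpha> \<beta> K) *v x =
        (saddle_mat \<alpha> \<beta> K ** saddle_precond \<alpha> \<beta> K) *v x"
      by (cases x rule: block_vec_cases)
        (simp add: matrix_vector_mul_assoc[symmetric] precond saddle block_mat_mult_block_vec
          commute matrix_vector_right_distrib matrix_vector_mult_diff_distrib
          matrix_vector_mult_scaleR)
  qed
  show "saddle_precond \<alpha> \<beta> K ** saddle_precond \<alpha> \<beta> K =
      saddle_mat \<alpha> \<beta> K ** saddle_mat \<alpha> \<beta> K"
    unfolding matrix_eq
  proof
    fix x
    show "(saddle_precond \<alpha> \<beta> K ** saddle_precond \<alpha> \<beta> K) *v x =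
        (saddle_mat \<alpha> \<beta> K ** saddle_mat \<alpha> \<beta> K) *v x"
      by (cases x rule: block_vec_cases)
        (simp add: matrix_vector_mul_assoc[symmetric] precond saddle block_mat_mult_block_vec
          S_square matrix_vector_right_distrib matrix_vector_mult_diff_distrib
          matrix_vector_mult_scaleR algebra_simps power2_eq_square)
  qed
qed

theorem theorem2:
  fixes \<alpha> \<beta> :: real
    and K :: "real ^ 'm ^ 'm"
    and a b :: "real ^ 'm"
    and x0 :: "real ^ ('m + 'm)"
  assumes "transpose K = K"
    and "invertible (saddle_mat \<alpha> \<beta> K)"
  shows "pos_def (saddle_precond \<alpha> \<beta> K) \<and>
    (\<exists>k\<le>2. saddle_mat \<alpha> \<beta> K *v
        minres_iterate (saddle_mat \<alpha> \<beta> K) (saddle_precond \<alpha> \<beta> K) (block_vec a b) x0 k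
      = block_vec a b)"
proof -
  let ?A = "saddle_mat \<alpha> \<beta> K" and ?P = "saddle_precond \<alpha> \<beta> K"
  have "invertible (?P ** ?P)"
    using assms by (simp add: saddle_precond_square invertible_mult)
  then have "\<exists>R. (R ** ?P) ** ?P = mat 1"
    unfolding invertible_left_inverse by (simp add: matrix_mul_assoc)
  then have "invertible ?P"
    unfolding invertible_left_inverse by blast
  then have P: "pos_def ?P"
    using pos_semidef_saddle_precond[OF assms(1)] by (rule pos_semidef_invertible_imp_pos_def[rotated])
  moreover have "?A *v minres_iterate ?A ?P (block_vec a b) x0 2 = block_vec a b"
    using P saddle_precond_commute[OF assms(1)] saddle_precond_square[OF assms(1)]
    by (rule minres_two_steps)
  ultimately show ?thesis by blast
qed

end
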